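(* ($\mathsf{ZFC}$) $\mathsf{BA}_{\rm Lip}(2^\omega)$ implies $\mathfrak{b}>\aleph_1$. Hence $\mathsf{BA}_{\rm Lip}(\omega^\omega)$ implies $\mathfrak{b}>\aleph_1$ as well.
   Context: On $\omega^\omega$ use the metric $d(x,y)=2^{-k}$ where $k$ is least with $x(k)\neq y(k)$ (and $d(x,x)=0$); $2^\omega$ carries the restricted metric. Lipschitz always means with constant $1$: $f$ is Lipschitz if for all $x,y$ in its domain and all $k<\omega$, $x\upharpoonright k=y\upharpoonright k$ implies $f(x)\upharpoonright k=f(y)\upharpoonright k$. A subset of a topological space is $\aleph_1$-dense if its intersection with every non-empty open set has size exactly $\aleph_1$. For $Z\in\{\omega^\omega,2^\omega\}$, $\mathsf{BA}_{\rm Lip}(Z)$ is the statement: for all $\aleph_1$-dense $A,B\subseteq Z$ there is a Lipschitz $f:Z\to Z$ such that $f\upharpoonright A$ is injective and $f``A\subseteq B$. For $f,g\in\omega^\omega$, $f\leq^* g$ means $f(k)\leq g(k)$ for all but finitely many $k$; the bounding number $\mathfrak{b}$ is the least size of a set $\mathcal B\subseteq\omega^\omega$ such that no single $g\in\omega^\omega$ satisfies $f\leq^* g$ for all $f\in\mathcal B$. *)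

theory Defs
  imports "HOL-Analysis.Analysis"
begin

unbundle cardinal_syntax

text \<open>The space \<open>\<omega>\<^sup>\<omega>\<close> is the type \<^typ>\<open>nat \<Rightarrow> nat\<close>; the space \<open>2\<^sup>\<omega>\<close> is a subset of it.\<close>

definition baire_space :: "(nat \<Rightarrow> nat) set"
  where "baire_space = UNIV"

definition cantor_space :: "(nat \<Rightarrow> nat) set"
  where "cantor_space = {x. \<forall>k. x k \<in> {0, 1}}"

definition baire_dist :: "(nat \<Rightarrow> nat) \<Rightarrow> (nat \<Rightarrow> nat) \<Rightarrow> real"
  where "baire_dist x y = (if x = y then 0 else (1 / 2) ^ (LEAST k. x k \<noteq> y k))"

definition restriction_eq :: "nat \<Rightarrow> (nat \<Rightarrow> nat) \<Rightarrow> (nat \<Rightarrow> nat) \<Rightarrow> bool"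
  where "restriction_eq k x y \<longleftrightarrow> (\<forall>i<k. x i = y i)"

lemma baire_dist_less_iff: "baire_dist x y < (1 / 2) ^ k \<longleftrightarrow> restriction_eq (Suc k) x y"
proof (cases "x = y")
  case True
  then show ?thesis by (simp add: baire_dist_def restriction_eq_def)
next
  case False
  define m where "m = (LEAST k. x k \<noteq> y k)"
  have m: "x m \<noteq> y m" 
  proof -
    obtain j where "x j \<noteq> y j" using False by auto
    then show ?thesis unfolding m_def by (rule LeastI)
  qed
  have less: "\<And>i. i < m \<Longrightarrow> x i = y i" unfolding m_def by (auto dest: not_less_Least)
  have "restriction_eq (Suc k) x y \<longleftrightarrow> k < m"
    unfolding restriction_eq_def
    by (metis m less less_Suc_eq_le linorder_not_less order_less_le_trans)
  moreover have "baire_dist x y = (1 / 2) ^ m" using False by (simp add: baire_dist_def m_def)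
  moreover have "((1 / 2 :: real) ^ m < (1 / 2) ^ k) \<longleftrightarrow> k < m"
    by (rule power_strict_decreasing_iff) auto
  ultimately show ?thesis by simp
qed

lemma baire_dist_le_iff: "baire_dist x y \<le> (1 / 2) ^ k \<longleftrightarrow> restriction_eq k x y"
proof (cases "x = y")
  case True
  then show ?thesis by (simp add: baire_dist_def restriction_eq_def)
next
  case False
  define m where "m = (LEAST k. x k \<noteq> y k)"
  have m: "x m \<noteq> y m" 
  proof -
    obtain j where "x j \<noteq> y j" using False by auto
    then show ?thesis unfolding m_def by (rule LeastI)
  qed
  have less: "\<And>i. i < m \<Longrightarrow> x i = y i" unfolding m_def by (auto dest: not_less_Least)
  have "restriction_eq k x y \<longleftrightarrow> k \<le> m"
    unfolding restriction_eq_def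
    by (metis m less linorder_not_less order_less_le_trans)
  moreover have "baire_dist x y = (1 / 2) ^ m" using False by (simp add: baire_dist_def m_def)
  moreover have "((1 / 2 :: real) ^ m \<le> (1 / 2) ^ k) \<longleftrightarrow> k \<le> m"
    by (rule power_decreasing_iff) auto
  ultimately show ?thesis by simp
qed

lemma Metric_space_baire_dist: "Metric_space Z baire_dist"
proof
  fix x y z :: "nat \<Rightarrow> nat"
  show nonneg: "0 \<le> baire_dist x y" by (simp add: baire_dist_def)
  show "baire_dist x y = baire_dist y x"
    by (simp add: baire_dist_def eq_commute)
  show "baire_dist x y = 0 \<longleftrightarrow> x = y" by (simp add: baire_dist_def)
  show "baire_dist x z \<le> baire_dist x y + baire_dist y z"
  proof (cases "x = z \<or> x = y \<or> y = z")
    case True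
    then show ?thesis by (auto simp: baire_dist_def)
  next
    case False
    then obtain m n where mn: "baire_dist x y = (1 / 2) ^ m" "baire_dist y z = (1 / 2) ^ n"
      by (auto simp: baire_dist_def)
    then have "restriction_eq m x y" "restriction_eq n y z"
      by (simp_all flip: baire_dist_le_iff)
    then have "restriction_eq (min m n) x z" by (auto simp: restriction_eq_def)
    then have "baire_dist x z \<le> (1 / 2) ^ min m n" by (simp add: baire_dist_le_iff)
    also have "\<dots> \<le> (1 / 2) ^ m + (1 / 2) ^ n" by (auto simp: min_def)
    finally show ?thesis using mn by simp
  qed
qed

abbreviation baire_topology :: "(nat \<Rightarrow> nat) set \<Rightarrow> (nat \<Rightarrow> nat) topology"
  where "baire_topology Z \<equiv> Metric_space.mtopology Z baire_dist"

text \<open>The metric topology is the subspace topology of the product topology of discrete factors,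
  i.e. of the library's topology on \<^typ>\<open>nat \<Rightarrow> nat\<close>.\<close>

lemma openin_baire_topology_iff:
  "openin (baire_topology Z) U \<longleftrightarrow>
    U \<subseteq> Z \<and> (\<forall>x\<in>U. \<exists>k. \<forall>y\<in>Z. restriction_eq k x y \<longrightarrow> y \<in> U)"
proof -
  interpret Metric_space Z baire_dist by (rule Metric_space_baire_dist)
  have "(\<exists>r>0. mball x r \<subseteq> U) \<longleftrightarrow> (\<exists>k. \<forall>y\<in>Z. restriction_eq k x y \<longrightarrow> y \<in> U)"
    if "x \<in> Z" for x
  proof
    assume "\<exists>r>0. mball x r \<subseteq> U"
    then obtain r where r: "r > 0" "mball x r \<subseteq> U" by blast
    obtain k where k: "(1 / 2) ^ k < r" using r(1) real_arch_pow_inv[of r "1/2"] by auto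
    have "y \<in> U" if "y \<in> Z" "restriction_eq k x y" for y
    proof -
      have "baire_dist x y < r" using that(2) k baire_dist_le_iff[of x y k] by linarith
      then show ?thesis using r(2) \<open>x \<in> Z\<close> that(1) by auto
    qed
    then show "\<exists>k. \<forall>y\<in>Z. restriction_eq k x y \<longrightarrow> y \<in> U" by blast
  next
    assume "\<exists>k. \<forall>y\<in>Z. restriction_eq k x y \<longrightarrow> y \<in> U"
    then obtain k where k: "\<forall>y\<in>Z. restriction_eq k x y \<longrightarrow> y \<in> U" by blast
    have "mball x ((1 / 2) ^ k) \<subseteq> U"
      using k by (auto simp: baire_dist_less_iff restriction_eq_def)
    then show "\<exists>r>0. mball x r \<subseteq> U" by (intro exI[of _ "(1/2)^k"]) auto
  qed
  then show ?thesis unfolding openin_mtopology by blast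
qed

lemma topspace_baire_topology: "topspace (baire_topology Z) = Z"
  using Metric_space.topspace_mtopology[OF Metric_space_baire_dist] .

lemma baire_topology_eq: "baire_topology Z = top_of_set Z"
proof -
  have op: "open {y. restriction_eq k x y}" for k and x :: "nat \<Rightarrow> nat"
  proof -
    have "{y. restriction_eq k x y} = (\<Inter>i\<in>{..<k}. (\<lambda>y. y i) -` {x i})"
      by (auto simp: restriction_eq_def)
    moreover have "open ((\<lambda>y::nat\<Rightarrow>nat. y i) -` {x i})" for i
      by (rule open_vimage) (auto simp: open_discrete continuous_on_product_coordinates)
    ultimately show ?thesis by auto
  qed
  have "openin (baire_topology Z) U \<longleftrightarrow> openin (top_of_set Z) U" for U
  proof
    assume "openin (baire_topology Z) U"
    then have sub: "U \<subseteq> Z" and ex: "\<forall>x\<in>U. \<exists>k. \<forall>y\<in>Z. restriction_eq k x y \<longrightarrow> y \<in> U"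
      by (auto simp: openin_baire_topology_iff)
    from bchoice[OF ex] obtain K where
      K: "\<And>x y. x \<in> U \<Longrightarrow> y \<in> Z \<Longrightarrow> restriction_eq (K x) x y \<Longrightarrow> y \<in> U" by blast
    define T where "T = (\<Union>x\<in>U. {y. restriction_eq (K x) x y})"
    have "open T" unfolding T_def using op by blast
    moreover have "U = Z \<inter> T" using sub K by (auto simp: T_def restriction_eq_def)
    ultimately show "openin (top_of_set Z) U" by (auto simp: openin_open)
  next
    assume "openin (top_of_set Z) U"
    then obtain T where T: "open T" "U = Z \<inter> T" by (auto simp: openin_open)
    have "\<exists>k. \<forall>y\<in>Z. restriction_eq k x y \<longrightarrow> y \<in> U" if "x \<in> U" for x
    proof -
      have "openin (product_topology (\<lambda>i. euclidean) UNIV) T" "x \<in> T"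
        using T that by (auto simp: open_fun_def)
      then obtain X where X: "x \<in> (\<Pi>\<^sub>E i\<in>UNIV. X i)" "finite {i. X i \<noteq> UNIV}"
        "(\<Pi>\<^sub>E i\<in>UNIV. X i) \<subseteq> T"
        using product_topology_open_contains_basis[of "\<lambda>i. euclidean" UNIV T x] by auto
      obtain k where k: "\<And>i. X i \<noteq> UNIV \<Longrightarrow> i < k"
        using X(2) unfolding finite_nat_set_iff_bounded by blast
      have "y \<in> T" if "restriction_eq k x y" for y
      proof -
        have "y i \<in> X i" for i
        proof (cases "X i = UNIV")
          case False
          then have "y i = x i" using k that by (simp add: restriction_eq_def)
          then show ?thesis using X(1) by (simp add: PiE_iff)
        qed simp
        then show ?thesis using X(3) by (auto simp: PiE_iff)
      qed
      then show ?thesis using T by blast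
    qed
    then show "openin (baire_topology Z) U" using T by (auto simp: openin_baire_topology_iff)
  qed
  then show ?thesis by (simp add: topology_eq)
qed

abbreviation aleph1 :: "nat set rel"
  where "aleph1 \<equiv> cardSuc natLeq"

definition aleph1_dense :: "'a topology \<Rightarrow> 'a set \<Rightarrow> bool"
  where "aleph1_dense X A \<longleftrightarrow>
    A \<subseteq> topspace X \<and> (\<forall>U. openin X U \<and> U \<noteq> {} \<longrightarrow> |A \<inter> U| =o aleph1)"

definition Lipschitz1_on :: "(nat \<Rightarrow> nat) set \<Rightarrow> ((nat \<Rightarrow> nat) \<Rightarrow> (nat \<Rightarrow> nat)) \<Rightarrow> bool"
  where "Lipschitz1_on Z f \<longleftrightarrow>
    (\<forall>x\<in>Z. \<forall>y\<in>Z. \<forall>k. restriction_eq k x y \<longrightarrow> restriction_eq k (f x) (f y))"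

lemma Lipschitz1_on_iff_dist:
  "Lipschitz1_on Z f \<longleftrightarrow> (\<forall>x\<in>Z. \<forall>y\<in>Z. baire_dist (f x) (f y) \<le> baire_dist x y)"
proof -
  have "(\<forall>k. restriction_eq k x y \<longrightarrow> restriction_eq k (f x) (f y)) \<longleftrightarrow>
      baire_dist (f x) (f y) \<le> baire_dist x y" for x y
  proof (cases "x = y")
    case True
    then show ?thesis by (simp add: baire_dist_def restriction_eq_def)
  next
    case False
    then obtain m where m: "baire_dist x y = (1 / 2) ^ m" by (auto simp: baire_dist_def)
    show ?thesis
      unfolding baire_dist_le_iff[symmetric] m
    proof
      assume "\<forall>k. (1 / 2 :: real) ^ m \<le> (1 / 2) ^ k \<longrightarrow> baire_dist (f x) (f y) \<le> (1 / 2) ^ k"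
      then show "baire_dist (f x) (f y) \<le> (1 / 2) ^ m" by blast
    next
      assume "baire_dist (f x) (f y) \<le> (1 / 2) ^ m"
      then show "\<forall>k. (1 / 2 :: real) ^ m \<le> (1 / 2) ^ k \<longrightarrow> baire_dist (f x) (f y) \<le> (1 / 2) ^ k"
        using order_trans by blast
    qed
  qed
  then show ?thesis by (simp add: Lipschitz1_on_def)
qed

definition BA_Lip :: "(nat \<Rightarrow> nat) set \<Rightarrow> bool"
  where "BA_Lip Z \<longleftrightarrow>
    (\<forall>A B. aleph1_dense (baire_topology Z) A \<and> aleph1_dense (baire_topology Z) B \<longrightarrow>
      (\<exists>f. f \<in> Z \<rightarrow> Z \<and> Lipschitz1_on Z f \<and> inj_on f A \<and> f ` A \<subseteq> B))"

definition eventually_dominated :: "(nat \<Rightarrow> nat) \<Rightarrow> (nat \<Rightarrow> nat) \<Rightarrow> bool"  (infix \<open>\<le>\<^sup>*\<close> 50)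
  where "f \<le>\<^sup>* g \<longleftrightarrow> (\<forall>\<^sub>\<infinity>k. f k \<le> g k)"

definition unbounded_family :: "(nat \<Rightarrow> nat) set \<Rightarrow> bool"
  where "unbounded_family B \<longleftrightarrow> \<not> (\<exists>g. \<forall>f\<in>B. f \<le>\<^sup>* g)"

text \<open>A cardinal number is represented by a cardinal order, up to \<open>=o\<close>. Up to \<open>=o\<close>, the value of
  \<open>bounding_number\<close> does not depend on the choice made by \<open>SOME\<close>.\<close>

definition bounding_number :: "(nat \<Rightarrow> nat) rel"
  where "bounding_number =
    |SOME B. unbounded_family B \<and> (\<forall>C. unbounded_family C \<longrightarrow> |B| \<le>o |C| )|"

lemma unbounded_family_UNIV: "unbounded_family UNIV"
proof -
  have "\<not> (\<lambda>k. Suc (g k)) \<le>\<^sup>* g" for g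
    by (simp add: eventually_dominated_def)
  then show ?thesis unfolding unbounded_family_def by blast
qed

lemma bounding_number_least:
  shows "\<exists>B. unbounded_family B \<and> bounding_number = |B|"
    and "unbounded_family C \<Longrightarrow> bounding_number \<le>o |C|"
proof -
  let ?P = "\<lambda>B. unbounded_family B \<and> (\<forall>C. unbounded_family C \<longrightarrow> |B| \<le>o |C| )"
  have "\<exists>r\<in>card_of ` Collect unbounded_family. \<forall>r'\<in>card_of ` Collect unbounded_family. r \<le>o r'"
    using unbounded_family_UNIV by (intro exists_minim_Card_order) (auto simp: card_of_Card_order)
  then have "\<exists>B. ?P B" by auto
  then have *: "?P (SOME B. ?P B)" by (rule someI_ex)
  then show "\<exists>B. unbounded_family B \<and> bounding_number = |B|"
    unfolding bounding_number_def by blast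
  show "bounding_number \<le>o |C|" if "unbounded_family C"
    using * that unfolding bounding_number_def by blast
qed

end

theory Submission
  imports Defs "HOL-Library.Countable_Set_Type"
begin

text \<open>If \<open>\<bb> \<le> \<aleph>\<^sub>1\<close>, an unbounded family \<open>(u\<^sub>\<alpha>)\<close> indexed by \<open>\<omega>\<^sub>1\<close> can be captured by slaloms
  \<open>S\<^sub>\<alpha>\<close> with \<open>|S\<^sub>\<alpha>(n)| = o(n)\<close> that increase with \<open>\<alpha>\<close> modulo finite, since the thin slaloms are countably
  directed. Let \<open>B\<close> consist of the codes of the \<open>S\<^sub>\<alpha>\<close>, up to finite modification. The sets of (codes of)
  slaloms of width at most \<open>n\<close> that contain \<open>S\<^sub>\<alpha>\<close> from some \<open>m\<close> on are closed, together they contain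
  all but countably many points coming from the tower, and no point lies in them for cofinally
  many \<open>\<alpha>\<close>: a slalom of finite width that eventually contains every \<open>S\<^sub>\<alpha>\<close> would bound the \<open>u\<^sub>\<alpha>\<close>.
  Hence every countable set is avoided by such closed sets containing almost all of \<open>B\<close>.

  On the other hand, let \<open>A\<close> contain the ranges of strictly increasing functions above the \<open>S\<^sub>\<alpha>\<close>.
  By unboundedness, a closed subset of \<open>2\<^sup>\<omega>\<close> without finitely supported points contains only countably
  many of these ranges. An injection \<open>f\<close> from \<open>A\<close> to \<open>B\<close>, continuous on \<open>2\<^sup>\<omega>\<close>, is then impossible: for large
  \<open>\<alpha>\<close>, the \<open>f\<close>-preimages of the closed sets for \<open>\<alpha>\<close> avoid the countably many finitely supported points.\<close>

section \<open>Thin slaloms and their countable directedness\<close>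

definition almost_sub :: "(nat \<Rightarrow> nat set) \<Rightarrow> (nat \<Rightarrow> nat set) \<Rightarrow> bool"  (infix \<open>\<subseteq>\<^sup>*\<close> 50)
  where "S \<subseteq>\<^sup>* T \<longleftrightarrow> (\<forall>\<^sub>\<infinity>n. S n \<subseteq> T n)"

text \<open>The clause over all \<open>j\<close> expresses \<open>card (S n) = o(n)\<close> without
  division. Unlike the plain bound \<open>card (S n) \<le> n\<close>, it survives finite
  unions.\<close>

definition thin_slalom :: "(nat \<Rightarrow> nat set) \<Rightarrow> bool"
  where "thin_slalom S \<longleftrightarrow> (\<forall>n. finite (S n)) \<and> (\<forall>j. \<forall>\<^sub>\<infinity>n. j * card (S n) \<le> n)"

lemma almost_sub_refl: "S \<subseteq>\<^sup>* S"
  by (simp add: almost_sub_def)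

lemma eventually_diagonal:
  fixes Q :: "nat \<Rightarrow> nat \<Rightarrow> bool"
  assumes "\<And>k. \<forall>\<^sub>\<infinity>n. Q k n"
  obtains \<kappa> where "\<And>k. \<forall>\<^sub>\<infinity>n. k \<le> \<kappa> n" "\<forall>\<^sub>\<infinity>n. Q (\<kappa> n) n"
proof -
  obtain N where N: "\<And>k n. n \<ge> N k \<Longrightarrow> Q k n"
    using assms unfolding cofinite_eq_sequentially eventually_sequentially by metis
  define M where "M n = insert 0 {k. k \<le> n \<and> N k \<le> n}" for n
  have fin: "finite (M n)" for n by (simp add: M_def)
  show thesis
  proof (rule that[of "\<lambda>n. Max (M n)"])
    fix k
    have "k \<le> Max (M n)" if "n \<ge> max k (N k)" for n
      using that fin by (intro Max_ge) (auto simp: M_def)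
    then show "\<forall>\<^sub>\<infinity>n. k \<le> Max (M n)"
      unfolding cofinite_eq_sequentially eventually_sequentially by blast
  next
    have "Q (Max (M n)) n" if "n \<ge> N 0" for n
    proof -
      have "Max (M n) \<in> M n" by (intro Max_in fin) (simp add: M_def)
      then have "N (Max (M n)) \<le> n" using that by (auto simp: M_def)
      then show ?thesis by (rule N)
    qed
    then show "\<forall>\<^sub>\<infinity>n. Q (Max (M n)) n"
      unfolding cofinite_eq_sequentially eventually_sequentially by blast
  qed
qed

lemma thin_slalom_Un:
  assumes "thin_slalom S" "thin_slalom T"
  shows "thin_slalom (\<lambda>n. S n \<union> T n)"
  unfolding thin_slalom_def
proof (intro conjI allI)
  show "finite (S n \<union> T n)" for n using assms by (simp add: thin_slalom_def)
  fix j
  \<comment> \<open>The factor 2 pays for adding two cardinalities.\<close>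
  have "\<forall>\<^sub>\<infinity>n. 2 * j * card (S n) \<le> n" "\<forall>\<^sub>\<infinity>n. 2 * j * card (T n) \<le> n"
    using assms by (simp_all add: thin_slalom_def)
  then show "\<forall>\<^sub>\<infinity>n. j * card (S n \<union> T n) \<le> n"
  proof eventually_elim
    case (elim n)
    have "j * card (S n \<union> T n) \<le> j * (card (S n) + card (T n))"
      by (intro mult_le_mono2 card_Un_le)
    then show ?case using elim by (simp add: algebra_simps)
  qed
qed

lemma thin_slalom_initial_UN:
  fixes k :: nat
  assumes "\<And>i. thin_slalom (S i)"
  shows "thin_slalom (\<lambda>n. \<Union>i\<le>k. S i n)"
proof (induction k)
  case 0
  then show ?case using assms[of 0] by simp
next
  case (Suc k)
  then show ?case using thin_slalom_Un[OF assms[of "Suc k"] Suc] by (simp add: atMost_Suc)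
qed

text \<open>A diagonal union: at \<open>n\<close>, unite the slaloms up to index
  \<open>\<kappa> n\<close>, where \<open>\<kappa>\<close> tends to infinity so slowly that
  \<open>\<kappa> n\<close> times the size of the union is still at most \<open>n\<close>.
  Divergence of \<open>\<kappa>\<close> yields both thinness and the almost inclusions.\<close>

lemma thin_slaloms_countably_directed:
  assumes "countable \<S>" "\<And>S. S \<in> \<S> \<Longrightarrow> thin_slalom S" "\<S> \<noteq> {}"
  obtains T where "thin_slalom T" "\<And>S. S \<in> \<S> \<Longrightarrow> S \<subseteq>\<^sup>* T"
proof -
  define s where "s = from_nat_into \<S>"
  have thin: "thin_slalom (s i)" for i
    using assms by (simp add: s_def from_nat_into)
  have "\<forall>\<^sub>\<infinity>n. k * card (\<Union>i\<le>k. s i n) \<le> n" for k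
    using thin_slalom_initial_UN[OF thin] by (simp add: thin_slalom_def)
  then obtain \<kappa> where \<kappa>: "\<And>k. \<forall>\<^sub>\<infinity>n. k \<le> \<kappa> n" "\<forall>\<^sub>\<infinity>n. \<kappa> n * card (\<Union>i\<le>\<kappa> n. s i n) \<le> n"
    using eventually_diagonal[of "\<lambda>k n. k * card (\<Union>i\<le>k. s i n) \<le> n"] by blast
  define T where "T n = (\<Union>i\<le>\<kappa> n. s i n)" for n
  show thesis
  proof
    show "thin_slalom T" unfolding thin_slalom_def
    proof (intro conjI allI)
      show "finite (T n)" for n using thin by (simp add: T_def thin_slalom_def)
      fix j
      from \<kappa>(1)[of j] \<kappa>(2) show "\<forall>\<^sub>\<infinity>n. j * card (T n) \<le> n"
      proof eventually_elim
        case (elim n)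
        have "j * card (T n) \<le> \<kappa> n * card (T n)" using elim(1) by (rule mult_le_mono1)
        also have "\<dots> \<le> n" using elim(2) unfolding T_def .
        finally show ?case .
      qed
    qed
    fix S assume "S \<in> \<S>"
    then obtain j where j: "S = s j"
      using from_nat_into_surj[OF assms(1)] unfolding s_def by metis
    have "\<forall>\<^sub>\<infinity>n. s j n \<subseteq> T n"
      using \<kappa>(1)[of j] by eventually_elim (auto simp: T_def)
    then show "S \<subseteq>\<^sup>* T" by (simp add: j almost_sub_def)
  qed
qed

text \<open>Well-founded recursion along \<open>r\<close>: the singleton slalom of
  \<open>u \<alpha>\<close> and the countably many earlier slaloms have a common thin upper
  bound.\<close>

lemma slalom_tower_exists:
  fixes r :: "'i rel" and u :: "'i \<Rightarrow> nat \<Rightarrow> nat"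
  assumes wo: "Well_order r" and count: "\<And>\<alpha>. countable (underS r \<alpha>)"
  obtains S where "\<And>\<alpha>. thin_slalom (S \<alpha>)" "\<And>\<alpha>. \<forall>\<^sub>\<infinity>n. u \<alpha> n \<in> S \<alpha> n"
    "\<And>\<alpha> \<beta>. \<beta> \<in> underS r \<alpha> \<Longrightarrow> S \<beta> \<subseteq>\<^sup>* S \<alpha>"
proof -
  define P where "P f \<alpha> T \<longleftrightarrow> thin_slalom T \<and> (\<forall>\<^sub>\<infinity>n. u \<alpha> n \<in> T n) \<and>
    (\<forall>\<beta>. (\<beta>, \<alpha>) \<in> r - Id \<longrightarrow> f \<beta> \<subseteq>\<^sup>* T)" for f :: "'i \<Rightarrow> nat \<Rightarrow> nat set" and \<alpha> T
  have "\<exists>f. \<forall>\<alpha>. P f \<alpha> (f \<alpha>)"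
  proof (rule dependent_wf_choice)
    show "wf (r - Id)" using wo by (simp add: well_order_on_def)
    show "P f \<alpha> T = P g \<alpha> T" if "\<And>z. (z, \<alpha>) \<in> r - Id \<Longrightarrow> f z = g z" for f g \<alpha> T
      unfolding P_def using that by metis
    fix \<alpha> f assume *: "\<And>\<beta>. (\<beta>, \<alpha>) \<in> r - Id \<Longrightarrow> P f \<beta> (f \<beta>)"
    have us: "underS r \<alpha> = {\<beta>. (\<beta>, \<alpha>) \<in> r - Id}" by (auto simp: underS_def)
    have "\<forall>\<^sub>\<infinity>n. j * card {u \<alpha> n} \<le> n" for j
      unfolding cofinite_eq_sequentially by (simp add: eventually_ge_at_top)
    then have su: "thin_slalom (\<lambda>n. {u \<alpha> n})" by (simp add: thin_slalom_def)
    obtain T where T: "thin_slalom T"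
        "\<And>S. S \<in> insert (\<lambda>n. {u \<alpha> n}) (f ` underS r \<alpha>) \<Longrightarrow> S \<subseteq>\<^sup>* T"
    proof (rule thin_slaloms_countably_directed[of "insert (\<lambda>n. {u \<alpha> n}) (f ` underS r \<alpha>)"])
      show "thin_slalom S" if "S \<in> insert (\<lambda>n. {u \<alpha> n}) (f ` underS r \<alpha>)" for S
        using that su * by (auto simp: us P_def)
    qed (use count in auto)
    have "\<forall>\<^sub>\<infinity>n. u \<alpha> n \<in> T n" using T(2)[of "\<lambda>n. {u \<alpha> n}"] by (simp add: almost_sub_def)
    then have "P f \<alpha> T" unfolding P_def using T us by auto
    then show "\<exists>T. P f \<alpha> T" by blast
  qed
  then obtain f where "\<And>\<alpha>. P f \<alpha> (f \<alpha>)" by blast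
  then show thesis by (intro that[of f]) (auto simp: P_def underS_def)
qed


section \<open>Finite modifications and aleph1-dense sets\<close>

definition sequences :: "nat set \<Rightarrow> (nat \<Rightarrow> nat) set"
  where "sequences V = {x. \<forall>k. x k \<in> V}"

definition patch :: "nat list \<Rightarrow> (nat \<Rightarrow> nat) \<Rightarrow> nat \<Rightarrow> nat"
  where "patch s x = (\<lambda>i. if i < length s then s ! i else x i)"

lemma patch_in_sequences: "s \<in> lists V \<Longrightarrow> x \<in> sequences V \<Longrightarrow> patch s x \<in> sequences V"
  by (auto simp: sequences_def patch_def)

lemma sequences_mono: "V \<subseteq> V' \<Longrightarrow> sequences V \<subseteq> sequences V'"
  by (auto simp: sequences_def)

lemma take_in_lists: "x \<in> sequences V \<Longrightarrow> map x [0..<k] \<in> lists V"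
  by (auto simp: sequences_def)

lemma patch_map_self: "length s = k \<Longrightarrow> patch (map x [0..<k]) (patch s x) = x"
  by (auto simp: patch_def fun_eq_iff)

text \<open>A patch is undone by patching back the overwritten initial segment, so \<open>x\<close>
  is determined by a finite list and a point of \<open>C\<close>.\<close>

lemma countable_patch_preimage:
  assumes "countable C"
  shows "countable {x. \<exists>s. patch s x \<in> C}"
proof (rule countable_subset)
  show "{x. \<exists>s. patch s x \<in> C} \<subseteq> (\<lambda>(t, y). patch t y) ` (UNIV \<times> C)"
  proof
    fix x assume "x \<in> {x. \<exists>s. patch s x \<in> C}"
    then obtain s where "patch s x \<in> C" by blast
    then show "x \<in> (\<lambda>(t, y). patch t y) ` (UNIV \<times> C)"
      by (intro image_eqI[of _ _ "(map x [0..<length s], patch s x)"]) (simp_all add: patch_map_self)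
  qed
qed (use assms in simp)

lemma uncountable_fibre:
  assumes "uncountable A" "countable (f ` A)"
  obtains y where "uncountable {x \<in> A. f x = y}"
proof -
  have "A = (\<Union>y\<in>f ` A. {x \<in> A. f x = y})" by auto
  then show thesis using assms that by (metis (no_types, lifting) countable_UN)
qed

lemma card_of_eq_aleph1_iff: "|A| =o aleph1 \<longleftrightarrow> |A| \<le>o aleph1 \<and> uncountable A"
proof -
  have "uncountable A \<longleftrightarrow> natLeq <o |A|"
    unfolding countable_card_le_natLeq
    using not_ordLeq_iff_ordLess[OF natLeq_Well_order card_of_Well_order] by blast
  also have "\<dots> \<longleftrightarrow> aleph1 \<le>o |A|"
    by (rule cardSuc_ordLess_ordLeq[OF natLeq_Card_order card_of_Card_order])
  finally show ?thesis by (auto simp: ordIso_iff_ordLeq)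
qed

definition modifications :: "nat set \<Rightarrow> (nat \<Rightarrow> nat) set \<Rightarrow> (nat \<Rightarrow> nat) set"
  where "modifications V X = (\<lambda>(s, x). patch s x) ` (lists V \<times> X)"

lemma subset_modifications: "X \<subseteq> modifications V X"
proof
  fix x assume "x \<in> X"
  then show "x \<in> modifications V X"
    unfolding modifications_def by (intro image_eqI[of _ _ "([], x)"]) (simp_all add: patch_def)
qed

lemma patch_in_modifications: "s \<in> lists V \<Longrightarrow> x \<in> X \<Longrightarrow> patch s x \<in> modifications V X"
  unfolding modifications_def by (intro image_eqI[of _ _ "(s, x)"]) simp_all

text \<open>There are only countably many lists, which gives the upper bound. For the lower bound, a
  nonempty open set contains a cylinder, and patching with its stem moves all of \<open>X\<close>
  into it; this cannot compress \<open>X\<close> to a countable set.\<close>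

lemma aleph1_dense_modifications:
  assumes X: "X \<subseteq> sequences V" "|X| =o aleph1"
  shows "aleph1_dense (baire_topology (sequences V)) (modifications V X)"
  unfolding aleph1_dense_def
proof (intro conjI allI impI)
  show "modifications V X \<subseteq> topspace (baire_topology (sequences V))"
    using X by (auto simp: topspace_baire_topology modifications_def intro!: patch_in_sequences)
  have C: "Card_order aleph1" by (simp add: cardSuc_Card_order natLeq_Card_order)
  have inf: "infinite (Field aleph1)"
    using cardSuc_finite[OF natLeq_Card_order] by (metis Field_natLeq infinite_UNIV_nat)
  have "|lists V| \<le>o natLeq" by (simp flip: countable_card_le_natLeq)
  then have "|lists V| \<le>o aleph1"
    using cardSuc_ordLeq[OF natLeq_Card_order] ordLeq_transitive by blast
  moreover have "|X| \<le>o aleph1" using X(2) by (simp add: card_of_eq_aleph1_iff)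
  ultimately have "|lists V \<times> X| \<le>o aleph1"
    using C inf by (rule_tac card_of_Times_ordLeq_infinite_Field)
  then have le: "|modifications V X| \<le>o aleph1"
    unfolding modifications_def using card_of_image ordLeq_transitive by blast
  fix U assume U: "openin (baire_topology (sequences V)) U \<and> U \<noteq> {}"
  then obtain x where x: "x \<in> U" "x \<in> sequences V"
    by (auto simp: openin_baire_topology_iff)
  with U obtain k where k: "\<And>y. y \<in> sequences V \<Longrightarrow> restriction_eq k x y \<Longrightarrow> y \<in> U"
    unfolding openin_baire_topology_iff by blast
  define s where "s = map x [0..<k]"
  have s: "s \<in> lists V" unfolding s_def using x(2) by (rule take_in_lists)
  have "patch s y \<in> modifications V X \<inter> U" if "y \<in> X" for y
  proof
    show "patch s y \<in> modifications V X" using s that by (rule patch_in_modifications)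
    show "patch s y \<in> U"
      using s that X(1) by (intro k patch_in_sequences) (auto simp: restriction_eq_def s_def patch_def)
  qed
  then have "X \<subseteq> {y. \<exists>s. patch s y \<in> modifications V X \<inter> U}" by blast
  moreover have "uncountable X" using X(2) by (simp add: card_of_eq_aleph1_iff)
  ultimately have "uncountable (modifications V X \<inter> U)"
    using countable_patch_preimage countable_subset by blast
  moreover have "|modifications V X \<inter> U| \<le>o aleph1"
    using le card_of_mono1[of "modifications V X \<inter> U"] ordLeq_transitive by blast
  ultimately show "|modifications V X \<inter> U| =o aleph1" by (simp add: card_of_eq_aleph1_iff)
qed

section \<open>Columns of a point and closed capturing sets\<close>

definition column :: "(nat \<Rightarrow> nat) \<Rightarrow> nat \<Rightarrow> nat set"
  where "column x n = {k. x (prod_encode (n, k)) \<noteq> 0}"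

text \<open>Since \<open>n \<le> prod_encode (n, k)\<close>, a patch of length \<open>l\<close>
  reaches only columns with index below \<open>l\<close>.\<close>

lemma column_patch: "\<forall>\<^sub>\<infinity>n. column (patch s x) n = column x n"
proof -
  have "column (patch s x) n = column x n" if "n \<ge> length s" for n
  proof -
    have "\<not> prod_encode (n, k) < length s" for k
      using that le_prod_encode_1[of n k] by linarith
    then show ?thesis by (simp add: column_def patch_def)
  qed
  then show ?thesis unfolding cofinite_eq_sequentially eventually_sequentially by blast
qed

definition captures :: "nat \<Rightarrow> (nat \<Rightarrow> nat set) \<Rightarrow> (nat \<Rightarrow> nat) set"
  where "captures m S = {x. \<forall>n\<ge>m. S n \<subseteq> column x n \<and> finite (column x n) \<and> card (column x n) \<le> n}"

text \<open>Failure at one \<open>n\<close> is visible on a finite set \<open>E\<close> of positions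
  in that column: either one missing element of \<open>S n\<close>, or more than \<open>n\<close>
  elements of the column, which an infinite column also contains.\<close>

lemma captures_closed:
  assumes "p \<notin> captures m S"
  obtains l where "\<And>y. restriction_eq l p y \<Longrightarrow> y \<notin> captures m S"
proof -
  obtain n where n: "n \<ge> m"
    "\<not> (S n \<subseteq> column p n \<and> finite (column p n) \<and> card (column p n) \<le> n)"
    using assms by (auto simp: captures_def)
  have "\<exists>E. finite E \<and> (\<forall>y. column y n \<inter> E = column p n \<inter> E \<longrightarrow> y \<notin> captures m S)"
  proof (cases "S n \<subseteq> column p n")
    case False
    then obtain k where "k \<in> S n" "k \<notin> column p n" by blast
    then show ?thesis using n(1) by (intro exI[of _ "{k}"]) (auto simp: captures_def)
  next
    case True
    then have "\<not> (finite (column p n) \<and> card (column p n) \<le> n)" using n(2) by blast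
    then obtain E where E: "E \<subseteq> column p n" "finite E" "\<not> card E \<le> n"
      using finite_if_finite_subsets_card_bdd[of "column p n" n] by blast
    have "y \<notin> captures m S" if "column y n \<inter> E = column p n \<inter> E" for y
    proof
      assume "y \<in> captures m S"
      then have "finite (column y n)" "card (column y n) \<le> n" using n(1) by (auto simp: captures_def)
      moreover have "E \<subseteq> column y n" using that E(1) by blast
      ultimately show False using E(3) card_mono order_trans by blast
    qed
    then show ?thesis using E(2) by blast
  qed
  then obtain E where E: "finite E" "\<And>y. column y n \<inter> E = column p n \<inter> E \<Longrightarrow> y \<notin> captures m S"
    by blast
  obtain l where l: "\<forall>i\<in>(\<lambda>k. prod_encode (n, k)) ` E. i < l"
    using E(1) finite_nat_set_iff_bounded[of "(\<lambda>k. prod_encode (n, k)) ` E"] by auto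
  show thesis
  proof (rule that, rule E(2))
    fix y assume "restriction_eq l p y"
    then have "y (prod_encode (n, k)) = p (prod_encode (n, k))" if "k \<in> E" for k
      using that l by (simp add: restriction_eq_def)
    then show "column y n \<inter> E = column p n \<inter> E" by (auto simp: column_def)
  qed
qed

section \<open>Unbounded towers of slaloms\<close>

locale unbounded_slalom_tower =
  fixes W :: "'i set" and S :: "'i \<Rightarrow> nat \<Rightarrow> nat set"
  assumes card_W: "|W| =o aleph1"
    and thin: "\<alpha> \<in> W \<Longrightarrow> thin_slalom (S \<alpha>)"
    and countable_not_above: "\<alpha> \<in> W \<Longrightarrow> countable {\<beta> \<in> W. \<not> S \<alpha> \<subseteq>\<^sup>* S \<beta>}"
    and unbounded: "\<not> (\<forall>\<alpha>\<in>W. S \<alpha> \<subseteq>\<^sup>* (\<lambda>n. {..g n}))"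
begin

lemma uncountable_W: "uncountable W"
  using card_W by (simp add: card_of_eq_aleph1_iff)

text \<open>An uncountable \<open>I\<close> meets the co-countable set of indices above any given
  \<alpha>, so a bound for \<open>I\<close> would bound the whole tower.\<close>

lemma unbounded_uncountable:
  assumes "I \<subseteq> W" "uncountable I"
  shows "\<not> (\<forall>\<alpha>\<in>I. S \<alpha> \<subseteq>\<^sup>* (\<lambda>n. {..g n}))"
proof
  assume I: "\<forall>\<alpha>\<in>I. S \<alpha> \<subseteq>\<^sup>* (\<lambda>n. {..g n})"
  have "S \<alpha> \<subseteq>\<^sup>* (\<lambda>n. {..g n})" if \<alpha>: "\<alpha> \<in> W" for \<alpha>
  proof -
    have "\<not> I \<subseteq> {\<beta> \<in> W. \<not> S \<alpha> \<subseteq>\<^sup>* S \<beta>}"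
      using countable_not_above[OF \<alpha>] assms(2) countable_subset by blast
    then obtain \<beta> where \<beta>: "\<beta> \<in> I" "S \<alpha> \<subseteq>\<^sup>* S \<beta>" using assms(1) by blast
    then have "S \<beta> \<subseteq>\<^sup>* (\<lambda>n. {..g n})" using I by blast
    with \<beta>(2) show ?thesis unfolding almost_sub_def by eventually_elim blast
  qed
  then show False using unbounded[of g] by blast
qed

lemma ex_above_countable:
  assumes "countable C" "C \<subseteq> W"
  obtains \<beta> where "\<beta> \<in> W" "\<And>\<alpha>. \<alpha> \<in> C \<Longrightarrow> S \<alpha> \<subseteq>\<^sup>* S \<beta>"
proof -
  have "countable (\<Union>\<alpha>\<in>C. {\<beta> \<in> W. \<not> S \<alpha> \<subseteq>\<^sup>* S \<beta>})"
    using assms countable_not_above by blast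
  then have "\<not> W \<subseteq> (\<Union>\<alpha>\<in>C. {\<beta> \<in> W. \<not> S \<alpha> \<subseteq>\<^sup>* S \<beta>})"
    using uncountable_W countable_subset by blast
  then show thesis using that by blast
qed

text \<open>Otherwise every \<open>S \<alpha>\<close> lies almost below some
  \<open>S \<beta>\<close> captured by \<open>p\<close>, and the maxima of the columns of
  \<open>p\<close> bound the tower. Values of \<open>Max\<close> at columns before \<open>m\<close>
  do not matter modulo finite.\<close>

lemma ex_never_captured:
  obtains \<alpha> where "\<alpha> \<in> W" "\<And>\<beta> m. S \<alpha> \<subseteq>\<^sup>* S \<beta> \<Longrightarrow> p \<notin> captures m (S \<beta>)"
proof (rule ccontr)
  assume "\<not> thesis"
  then have *: "\<exists>\<beta> m. S \<alpha> \<subseteq>\<^sup>* S \<beta> \<and> p \<in> captures m (S \<beta>)" if "\<alpha> \<in> W" for \<alpha>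
    using that \<open>\<And>\<alpha>. \<lbrakk>\<alpha> \<in> W; \<And>\<beta> m. S \<alpha> \<subseteq>\<^sup>* S \<beta> \<Longrightarrow> p \<notin> captures m (S \<beta>)\<rbrakk> \<Longrightarrow> thesis\<close> by blast
  have "S \<alpha> \<subseteq>\<^sup>* (\<lambda>n. {..Max (column p n)})" if \<alpha>: "\<alpha> \<in> W" for \<alpha>
  proof -
    obtain \<beta> m where \<beta>: "S \<alpha> \<subseteq>\<^sup>* S \<beta>" "p \<in> captures m (S \<beta>)" using *[OF \<alpha>] by blast
    have "\<forall>\<^sub>\<infinity>n. n \<ge> m" unfolding cofinite_eq_sequentially by (rule eventually_ge_at_top)
    with \<beta>(1) show ?thesis unfolding almost_sub_def
    proof eventually_elim
      case (elim n)
      then have "S \<alpha> n \<subseteq> column p n" "finite (column p n)"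
        using \<beta>(2) by (auto simp: captures_def)
      then show ?case by (auto intro: Max_ge)
    qed
  qed
  then show False using unbounded[of "\<lambda>n. Max (column p n)"] by simp
qed

section \<open>Codes of slaloms\<close>

definition code :: "'i \<Rightarrow> nat \<Rightarrow> nat"
  where "code \<alpha> i = (case prod_decode i of (n, k) \<Rightarrow> if k \<in> S \<alpha> n then 1 else 0)"

lemma column_code: "column (code \<alpha>) n = S \<alpha> n"
  by (simp add: column_def code_def)

lemma code_in_cantor: "code \<alpha> \<in> cantor_space"
  by (auto simp: code_def cantor_space_def split: prod.split)

text \<open>A patch affects only finitely many columns, and thinness with \<open>j = 1\<close>
  supplies the width bound.\<close>

lemma patch_code_captured:
  assumes "\<beta> \<in> W" "S \<alpha> \<subseteq>\<^sup>* S \<beta>"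
  obtains m where "patch s (code \<beta>) \<in> captures m (S \<alpha>)"
proof -
  have fin: "\<And>n. finite (S \<beta> n)" and "\<forall>\<^sub>\<infinity>n. 1 * card (S \<beta> n) \<le> n"
    using thin[OF assms(1)] unfolding thin_slalom_def by blast+
  from this(2) assms(2) column_patch[of s "code \<beta>"]
  have "\<forall>\<^sub>\<infinity>n. S \<alpha> n \<subseteq> column (patch s (code \<beta>)) n \<and> finite (column (patch s (code \<beta>)) n) \<and>
      card (column (patch s (code \<beta>)) n) \<le> n"
    unfolding almost_sub_def by eventually_elim (simp add: column_code fin)
  then show thesis
    using that unfolding captures_def cofinite_eq_sequentially eventually_sequentially by blast
qed

section \<open>Sparse codes and their concentration on finitely supported points\<close>

definition envelope :: "'i \<Rightarrow> nat \<Rightarrow> nat"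
  where "envelope \<alpha> n = (\<Sum>i\<le>n. Suc (Max (insert 0 (S \<alpha> i))))"

text \<open>Coding the range of the envelope, not its graph, turns fast growth into long runs of
  zeros.\<close>

definition sparse_code :: "'i \<Rightarrow> nat \<Rightarrow> nat"
  where "sparse_code \<alpha> j = (if j \<in> range (envelope \<alpha>) then 1 else 0)"

lemma sparse_code_in_cantor: "sparse_code \<alpha> \<in> cantor_space"
  by (auto simp: sparse_code_def cantor_space_def)

lemma strict_mono_envelope: "strict_mono (envelope \<alpha>)"
  by (simp add: strict_mono_Suc_iff envelope_def)

lemma envelope_bound: "\<alpha> \<in> W \<Longrightarrow> S \<alpha> n \<subseteq> {..envelope \<alpha> n}"
proof
  fix k assume \<alpha>: "\<alpha> \<in> W" and k: "k \<in> S \<alpha> n"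
  have "finite (S \<alpha> n)" using thin[OF \<alpha>] by (simp add: thin_slalom_def)
  then have "k \<le> Suc (Max (insert 0 (S \<alpha> n)))" using k by (intro le_SucI Max_ge) auto
  also have "\<dots> \<le> envelope \<alpha> n" unfolding envelope_def
    by (rule member_le_sum[of n "{..n}" "\<lambda>i. Suc (Max (insert 0 (S \<alpha> i)))"]) auto
  finally show "k \<in> {..envelope \<alpha> n}" by simp
qed

text \<open>Iterating \<open>g\<close> gives one function \<open>G\<close> above all envelopes with
  index in \<open>I\<close>, hence above their slaloms. This is impossible for uncountable
  \<open>I\<close>.\<close>

lemma hits_bounded_gaps_imp_countable:
  assumes "I \<subseteq> W"
    and hits: "\<And>\<alpha> k. \<alpha> \<in> I \<Longrightarrow> \<exists>j. k \<le> j \<and> j < g k \<and> sparse_code \<alpha> j \<noteq> 0"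
  shows "countable I"
proof (rule ccontr)
  assume unc: "uncountable I"
  define G where "G = rec_nat (g 0) (\<lambda>_ v. g (Suc v))"
  have envelope_le: "envelope \<alpha> n \<le> G n" if \<alpha>: "\<alpha> \<in> I" for \<alpha> n
  proof (induction n)
    case 0
    obtain i where "envelope \<alpha> i < g 0"
      using hits[OF \<alpha>, of 0] by (auto simp: sparse_code_def split: if_splits)
    moreover have "envelope \<alpha> 0 \<le> envelope \<alpha> i" using strict_mono_envelope by (simp add: strict_mono_less_eq)
    ultimately show ?case by (simp add: G_def)
  next
    case (Suc n)
    \<comment> \<open>Searching from \<open>Suc (G n)\<close> finds a value strictly beyond
      \<open>envelope \<alpha> n\<close>, hence at or beyond the next one.\<close>
    obtain i where i: "Suc (G n) \<le> envelope \<alpha> i" "envelope \<alpha> i < g (Suc (G n))"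
      using hits[OF \<alpha>, of "Suc (G n)"] by (auto simp: sparse_code_def split: if_splits)
    have "envelope \<alpha> n < envelope \<alpha> i" using Suc i(1) by linarith
    then have "envelope \<alpha> (Suc n) \<le> envelope \<alpha> i"
      using strict_mono_envelope by (simp add: strict_mono_less strict_mono_less_eq)
    then show ?case using i(2) by (simp add: G_def)
  qed
  have "S \<alpha> \<subseteq>\<^sup>* (\<lambda>n. {..G n})" if \<alpha>: "\<alpha> \<in> I" for \<alpha>
  proof -
    have "S \<alpha> n \<subseteq> {..G n}" for n
      using envelope_bound[of \<alpha> n] envelope_le[OF \<alpha>, of n] \<alpha> assms(1) by fastforce
    then show ?thesis by (simp add: almost_sub_def)
  qed
  then show False using unbounded_uncountable[OF assms(1) unc, of G] by simp
qed

lemma card_codes: "|code ` W| =o aleph1"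
proof -
  have "uncountable (code ` W)"
  proof
    assume "countable (code ` W)"
    then obtain y where y: "uncountable {\<alpha> \<in> W. code \<alpha> = y}"
      using uncountable_W uncountable_fibre by blast
    have "S \<alpha> \<subseteq>\<^sup>* (\<lambda>n. {..Max (column y n)})" if "\<alpha> \<in> {\<alpha> \<in> W. code \<alpha> = y}" for \<alpha>
    proof -
      have "S \<alpha> = column y" using that column_code[of \<alpha>] by auto
      moreover have "finite (S \<alpha> n)" for n using that thin by (auto simp: thin_slalom_def)
      ultimately have "S \<alpha> n \<subseteq> {..Max (column y n)}" for n by (auto intro: Max_ge)
      then show ?thesis by (simp add: almost_sub_def)
    qed
    then show False
      using unbounded_uncountable[OF _ y, of "\<lambda>n. Max (column y n)"] by fastforce
  qed
  moreover have "|code ` W| \<le>o aleph1"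
    using card_of_image card_W ordLeq_ordIso_trans by blast
  ultimately show ?thesis by (simp add: card_of_eq_aleph1_iff)
qed

text \<open>All indices in a fibre share one range, whose own gaps provide the function needed to
  make the fibre countable.\<close>

lemma card_sparse_codes: "|sparse_code ` W| =o aleph1"
proof -
  have "uncountable (sparse_code ` W)"
  proof
    assume "countable (sparse_code ` W)"
    then obtain y where y: "uncountable {\<alpha> \<in> W. sparse_code \<alpha> = y}"
      using uncountable_W uncountable_fibre by blast
    then have "{\<alpha> \<in> W. sparse_code \<alpha> = y} \<noteq> {}" by (metis countable_empty)
    then obtain \<gamma> where \<gamma>: "sparse_code \<gamma> = y" by blast
    have "k \<le> envelope \<gamma> k \<and> envelope \<gamma> k < Suc (envelope \<gamma> k) \<and> y (envelope \<gamma> k) \<noteq> 0" for k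
      using strict_mono_imp_increasing[OF strict_mono_envelope] \<gamma> by (auto simp: sparse_code_def)
    then have "countable {\<alpha> \<in> W. sparse_code \<alpha> = y}"
      by (intro hits_bounded_gaps_imp_countable[of _ "\<lambda>k. Suc (envelope \<gamma> k)"]) auto
    then show False using y by blast
  qed
  moreover have "|sparse_code ` W| \<le>o aleph1"
    using card_of_image card_W ordLeq_ordIso_trans by blast
  ultimately show ?thesis by (simp add: card_of_eq_aleph1_iff)
qed

text \<open>Each finitely supported point has a neighbourhood that \<open>f\<close> maps off the
  closed set. A sparse code outside these neighbourhoods has a nonzero value soon after every
  \<open>k\<close>, so its gaps are bounded independently of \<alpha>.\<close>

lemma concentrated:
  assumes lip: "Lipschitz1_on cantor_space f"
    and avoid: "\<And>s. s \<in> lists {0, 1} \<Longrightarrow> f (patch s (\<lambda>_. 0)) \<notin> captures m T"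
  shows "countable {\<alpha> \<in> W. f (sparse_code \<alpha>) \<in> captures m T}"
proof -
  have "\<exists>l. \<forall>y\<in>cantor_space. restriction_eq l (patch s (\<lambda>_. 0)) y \<longrightarrow> f y \<notin> captures m T"
    if s: "s \<in> lists {0, 1}" for s
  proof -
    obtain l where "\<And>y. restriction_eq l (f (patch s (\<lambda>_. 0))) y \<Longrightarrow> y \<notin> captures m T"
      using captures_closed[OF avoid[OF s]] by blast
    moreover have "patch s (\<lambda>_. 0) \<in> cantor_space"
      using patch_in_sequences[OF s] by (auto simp: sequences_def cantor_space_def)
    ultimately show ?thesis using lip unfolding Lipschitz1_on_def by blast
  qed
  then obtain l where l: "\<And>s y. s \<in> lists {0, 1} \<Longrightarrow> y \<in> cantor_space \<Longrightarrow>
      restriction_eq (l s) (patch s (\<lambda>_. 0)) y \<Longrightarrow> f y \<notin> captures m T" by metis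
  \<comment> \<open>The maximum exists because there are finitely many 0-1 lists of each length: the
    compactness of the Cantor space.\<close>
  define g where "g k = Max (l ` {s. set s \<subseteq> {0, 1} \<and> length s = k})" for k
  show ?thesis
  proof (rule hits_bounded_gaps_imp_countable[of _ g])
    fix \<alpha> k assume \<alpha>: "\<alpha> \<in> {\<alpha> \<in> W. f (sparse_code \<alpha>) \<in> captures m T}"
    define s where "s = map (sparse_code \<alpha>) [0..<k]"
    have s: "set s \<subseteq> {0, 1}" "length s = k" by (auto simp: s_def sparse_code_def)
    then have ls: "l s \<le> g k"
      unfolding g_def by (intro Max_ge) (auto intro: finite_lists_length_eq)
    have "\<not> restriction_eq (l s) (patch s (\<lambda>_. 0)) (sparse_code \<alpha>)"
      using l[OF _ sparse_code_in_cantor, of s \<alpha>] s(1) \<alpha> by auto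
    \<comment> \<open>The zero extension of \<open>s\<close> agrees with the code below
      \<open>k\<close>, so any difference lies at or after \<open>k\<close> and is a nonzero
      value.\<close>
    then obtain j where "j < l s" "patch s (\<lambda>_. 0) j \<noteq> sparse_code \<alpha> j"
      by (auto simp: restriction_eq_def)
    then have "k \<le> j \<and> j < g k \<and> sparse_code \<alpha> j \<noteq> 0"
      using ls by (auto simp: patch_def s_def split: if_splits)
    then show "\<exists>j. k \<le> j \<and> j < g k \<and> sparse_code \<alpha> j \<noteq> 0" ..
  qed auto
qed

section \<open>The contradiction from an injection\<close>

lemma no_injection_into_codes:
  assumes lip: "Lipschitz1_on cantor_space f"
    and inj: "inj_on f (sparse_code ` W)"
    and into: "f ` sparse_code ` W \<subseteq> modifications V (code ` W)"
  shows False
proof -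
  \<comment> \<open>\<open>Q\<close> collects the values of \<open>f\<close> at the finitely
    supported points. As it is countable, one \<alpha> can lie above the indices \<open>h p\<close>
    of all its members, and the capturing sets for this \<alpha> avoid \<open>Q\<close>.\<close>
  define Q where "Q = (\<lambda>s. f (patch s (\<lambda>_. 0))) ` lists {0, 1::nat}"
  have "\<exists>\<alpha>. \<alpha> \<in> W \<and> (\<forall>\<beta> m. S \<alpha> \<subseteq>\<^sup>* S \<beta> \<longrightarrow> p \<notin> captures m (S \<beta>))" for p
    using ex_never_captured by metis
  then obtain h where h: "\<And>p. h p \<in> W"
      "\<And>p \<beta> m. S (h p) \<subseteq>\<^sup>* S \<beta> \<Longrightarrow> p \<notin> captures m (S \<beta>)"
    by metis
  have "countable (h ` Q)" by (simp add: Q_def)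
  moreover have "h ` Q \<subseteq> W" using h(1) by blast
  ultimately obtain \<alpha> where \<alpha>: "\<alpha> \<in> W" "\<And>p. p \<in> Q \<Longrightarrow> S (h p) \<subseteq>\<^sup>* S \<alpha>"
    by (rule ex_above_countable) blast
  have few: "countable (\<Union>m. {\<gamma> \<in> W. f (sparse_code \<gamma>) \<in> captures m (S \<alpha>)})"
    using h(2) \<alpha>(2) by (intro countable_UN concentrated[OF lip]) (auto simp: Q_def)
  define N where "N = modifications V (code ` {\<beta> \<in> W. \<not> S \<alpha> \<subseteq>\<^sup>* S \<beta>})"
  have "countable N"
    unfolding N_def modifications_def using countable_not_above[OF \<alpha>(1)] by simp
  \<comment> \<open>A value built from a code above \<open>S \<alpha>\<close> is captured for some
    \<open>m\<close>, so concentration leaves countably many such points. All other values lie in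
    the countable \<open>N\<close>, whose preimage is countable by injectivity.\<close>
  have "sparse_code ` W \<subseteq>
    (sparse_code ` (\<Union>m. {\<gamma> \<in> W. f (sparse_code \<gamma>) \<in> captures m (S \<alpha>)})) \<union>
    {x \<in> sparse_code ` W. f x \<in> N}"
  proof
    fix x assume "x \<in> sparse_code ` W"
    then obtain \<gamma> where \<gamma>: "\<gamma> \<in> W" "x = sparse_code \<gamma>" by blast
    have "f x \<in> modifications V (code ` W)" using into \<gamma> by blast
    then obtain s \<beta> where \<beta>: "s \<in> lists V" "\<beta> \<in> W" "f x = patch s (code \<beta>)"
      by (auto simp: modifications_def)
    show "x \<in> (sparse_code ` (\<Union>m. {\<gamma> \<in> W. f (sparse_code \<gamma>) \<in> captures m (S \<alpha>)})) \<union>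
      {x \<in> sparse_code ` W. f x \<in> N}"
    proof (cases "S \<alpha> \<subseteq>\<^sup>* S \<beta>")
      case True
      then obtain m where "f x \<in> captures m (S \<alpha>)"
        using patch_code_captured[OF \<beta>(2)] \<beta>(3) by metis
      then show ?thesis using \<gamma> by blast
    next
      case False
      then have "f x \<in> N"
        unfolding N_def \<beta>(3) using \<beta>(1,2) by (intro patch_in_modifications) auto
      then show ?thesis using \<gamma> by blast
    qed
  qed
  moreover have "countable {x \<in> sparse_code ` W. f x \<in> N}"
  proof (rule countable_image_inj_on[where f = f])
    show "countable (f ` {x \<in> sparse_code ` W. f x \<in> N})"
      by (rule countable_subset[OF _ \<open>countable N\<close>]) auto
    show "inj_on f {x \<in> sparse_code ` W. f x \<in> N}"
      using inj by (rule inj_on_subset) auto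
  qed
  ultimately have "countable (sparse_code ` W)"
    using few by (meson countable_Un countable_image countable_subset)
  then show False using card_sparse_codes by (simp add: card_of_eq_aleph1_iff)
qed

text \<open>The choices \<open>{0, 1}\<close> and \<open>UNIV\<close> for \<open>V\<close> give the
  two spaces. In either case it suffices to restrict \<open>f\<close> to
  \<open>cantor_space\<close>; its values need not stay there.\<close>

lemma not_BA_Lip:
  assumes "{0, 1} \<subseteq> V"
  shows "\<not> BA_Lip (sequences V)"
proof
  assume BA: "BA_Lip (sequences V)"
  have cantor: "cantor_space \<subseteq> sequences V"
    using sequences_mono[OF assms] by (simp add: cantor_space_def sequences_def)
  have "sparse_code ` W \<subseteq> sequences V" "code ` W \<subseteq> sequences V"
    using cantor code_in_cantor sparse_code_in_cantor by blast+
  then have "aleph1_dense (baire_topology (sequences V)) (modifications V (sparse_code ` W))"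
    "aleph1_dense (baire_topology (sequences V)) (modifications V (code ` W))"
    by (simp_all add: aleph1_dense_modifications card_codes card_sparse_codes)
  then obtain f where f: "Lipschitz1_on (sequences V) f"
    "inj_on f (modifications V (sparse_code ` W))"
    "f ` modifications V (sparse_code ` W) \<subseteq> modifications V (code ` W)"
    using BA unfolding BA_Lip_def by blast
  have sub: "sparse_code ` W \<subseteq> modifications V (sparse_code ` W)"
    by (rule subset_modifications)
  show False
  proof (rule no_injection_into_codes)
    show "Lipschitz1_on cantor_space f" using f(1) cantor by (auto simp: Lipschitz1_on_def)
    show "inj_on f (sparse_code ` W)" using f(2) sub by (rule inj_on_subset)
    show "f ` sparse_code ` W \<subseteq> modifications V (code ` W)" using f(3) sub by blast
  qed
qed

end

section \<open>From a small unbounded family to a tower\<close>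

lemma unbounded_slalom_tower_exists:
  assumes "\<not> aleph1 <o bounding_number"
  obtains W and S :: "nat set \<Rightarrow> nat \<Rightarrow> nat set" where "unbounded_slalom_tower W S"
proof -
  have C: "Card_order aleph1" by (simp add: cardSuc_Card_order natLeq_Card_order)
  then have wo: "Well_order aleph1" by (simp add: card_order_on_def)
  obtain B where B: "unbounded_family B" "bounding_number = |B|"
    using bounding_number_least(1) by blast
  then have "|B| \<le>o aleph1"
    using assms not_ordLess_iff_ordLeq[OF card_of_Well_order wo] by metis
  moreover have F: "|Field aleph1| =o aleph1" using C by (rule card_of_Field_ordIso)
  ultimately have "|B| \<le>o |Field aleph1|"
    using ordIso_symmetric ordLeq_ordIso_trans by blast
  moreover have "B \<noteq> {}" using B(1) by (auto simp: unbounded_family_def)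
  ultimately obtain u where u: "u ` Field aleph1 = B" using card_of_ordLeq2 by metis
  have us: "countable (underS aleph1 \<alpha>)" for \<alpha>
  proof (cases "\<alpha> \<in> Field aleph1")
    case True
    \<comment> \<open>Below the successor of \<open>natLeq\<close> means at most
      \<open>natLeq\<close>, so proper initial segments are countable.\<close>
    then have "|underS aleph1 \<alpha>| <o aleph1" using C by (rule_tac card_of_underS)
    then show ?thesis
      by (simp add: countable_card_le_natLeq cardSuc_ordLeq_ordLess natLeq_Card_order card_of_Card_order)
  next
    case False
    then have "underS aleph1 \<alpha> = {}" by (auto simp: underS_def Field_def)
    then show ?thesis by simp
  qed
  obtain S where S: "\<And>\<alpha>. thin_slalom (S \<alpha>)" "\<And>\<alpha>. \<forall>\<^sub>\<infinity>n. u \<alpha> n \<in> S \<alpha> n"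
    "\<And>\<alpha> \<beta>. \<beta> \<in> underS aleph1 \<alpha> \<Longrightarrow> S \<beta> \<subseteq>\<^sup>* S \<alpha>"
    using slalom_tower_exists[OF wo us] by blast
  have "unbounded_slalom_tower (Field aleph1) S"
  proof
    fix \<alpha> assume \<alpha>: "\<alpha> \<in> Field aleph1"
    \<comment> \<open>By totality, an index whose slalom is not above \<open>S \<alpha>\<close> must
      precede \<alpha>.\<close>
    have "{\<beta> \<in> Field aleph1. \<not> S \<alpha> \<subseteq>\<^sup>* S \<beta>} \<subseteq> underS aleph1 \<alpha>"
    proof
      fix \<beta> assume \<beta>: "\<beta> \<in> {\<beta> \<in> Field aleph1. \<not> S \<alpha> \<subseteq>\<^sup>* S \<beta>}"
      then have "\<alpha> \<noteq> \<beta>" using almost_sub_refl by blast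
      moreover have "(\<alpha>, \<beta>) \<notin> aleph1" using \<beta> S(3)[of \<alpha> \<beta>] \<open>\<alpha> \<noteq> \<beta>\<close> by (auto simp: underS_def)
      moreover have "total_on (Field aleph1) aleph1"
        using wo by (simp add: well_order_on_def linear_order_on_def)
      ultimately show "\<beta> \<in> underS aleph1 \<alpha>"
        using \<alpha> \<beta> by (auto simp: underS_def total_on_def)
    qed
    then show "countable {\<beta> \<in> Field aleph1. \<not> S \<alpha> \<subseteq>\<^sup>* S \<beta>}" using us countable_subset by blast
  next
    fix g
    show "\<not> (\<forall>\<alpha>\<in>Field aleph1. S \<alpha> \<subseteq>\<^sup>* (\<lambda>n. {..g n}))"
    proof
      assume *: "\<forall>\<alpha>\<in>Field aleph1. S \<alpha> \<subseteq>\<^sup>* (\<lambda>n. {..g n})"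
      \<comment> \<open>As \<open>S \<alpha>\<close> eventually contains the values of
        \<open>u \<alpha>\<close>, a bound for the tower is a bound for \<open>B\<close>.\<close>
      have "u \<alpha> \<le>\<^sup>* g" if "\<alpha> \<in> Field aleph1" for \<alpha>
      proof -
        have "\<forall>\<^sub>\<infinity>n. S \<alpha> n \<subseteq> {..g n}" using * that by (simp add: almost_sub_def)
        with S(2)[of \<alpha>] show ?thesis
          unfolding eventually_dominated_def by eventually_elim auto
      qed
      then show False using B(1) u unfolding unbounded_family_def by blast
    qed
  qed (use F S(1) in auto)
  then show thesis by (rule that)
qed

theorem theorem1p4:
  shows "(BA_Lip cantor_space \<longrightarrow> aleph1 <o bounding_number) \<and>
         (BA_Lip baire_space \<longrightarrow> aleph1 <o bounding_number)"
proof -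
  have "\<not> BA_Lip cantor_space \<and> \<not> BA_Lip baire_space" if b: "\<not> aleph1 <o bounding_number"
  proof -
    obtain W and S :: "nat set \<Rightarrow> nat \<Rightarrow> nat set" where "unbounded_slalom_tower W S"
      using b by (rule unbounded_slalom_tower_exists)
    then interpret unbounded_slalom_tower W S .
    have "cantor_space = sequences {0, 1}" "baire_space = sequences UNIV"
      by (simp_all add: cantor_space_def baire_space_def sequences_def)
    then show ?thesis using not_BA_Lip[of "{0, 1}"] not_BA_Lip[of UNIV] by simp
  qed
  then show ?thesis by blast
qed

end
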